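(* Let $\ell\ge2$ be an integer and let $\beta$ be an irrational real number with continued fraction convergents $(p_n/q_n)_{n\ge 0}$. Let $g(x)=\beta x^{\ell}$, let $\Sigma$ be a finite alphabet, and let $c\colon[0,1)\to\Sigma$ be a non-constant piecewise-constant function with partition boundaries $0=\gamma_0<\gamma_1<\cdots<\gamma_d=1$ that are all rational. Let $\mathbf{a}=a_0a_1a_2\cdots$ be defined by $a_n=c(\{g(n)\})$ for $n\ge0$. If $$\limsup_{n\to\infty}\frac{q_{n+1}}{q_n^{\ell}}=\infty,$$ then $\mathbf{Dio}(\mathbf{a})=\infty$.
   Context: $\{\cdot\}$ denotes the fractional part. That $c$ is piecewise constant with partition boundaries $0=\gamma_0<\cdots<\gamma_d=1$ means that $c$ is constant on each interval $[\gamma_{j-1},\gamma_j)$, $1\le j\le d$. The convergents of $\beta=[w_0;w_1,w_2,\dots]$ are $p_n/q_n=[w_0;w_1,\dots,w_n]$, in lowest terms with $q_n\ge1$. For integers $0\le r\le s$, $\mathbf{a}[r,s]$ denotes the finite word $a_ra_{r+1}\cdots a_s$. Diophantine exponent: $\mathbf{Dio}(\mathbf{a})\in[1,\infty]$ is the supremum of the real numbers $\rho$ for which there exist three sequences of integers $(r_n)_{n\ge0}$, $(s_n)_{n\ge0}$, $(t_n)_{n\ge0}$ such that, for all $n\ge 0$, $-1\le r_n<s_n<t_n$, the words $\mathbf{a}[r_n+1,r_n+t_n-s_n]$ and $\mathbf{a}[s_n+1,t_n]$ coincide, $t_n\ge\rho s_n$, and moreover $s_n-r_n\to\infty$ as $n\to\infty$.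 *)

theory Defs
  imports "HOL-Analysis.Analysis"
begin

text \<open>
  For irrational \<open>\<beta>\<close> the recursion never reaches an integer, so the division by
  \<open>frac\<close> is always a genuine one.
\<close>

primrec complete_quotient :: "real \<Rightarrow> nat \<Rightarrow> real" where
  "complete_quotient \<beta> 0 = \<beta>"
| "complete_quotient \<beta> (Suc n) = 1 / frac (complete_quotient \<beta> n)"

definition partial_quotient :: "real \<Rightarrow> nat \<Rightarrow> int" where
  "partial_quotient \<beta> n = \<lfloor>complete_quotient \<beta> n\<rfloor>"

text \<open>The value \<open>[w\<^sub>0; w\<^sub>1, \<dots>, w\<^sub>n]\<close>; the empty list is a dummy case.\<close>

fun cfrac_value :: "int list \<Rightarrow> rat" where
  "cfrac_value [] = 0"
| "cfrac_value [w] = of_int w"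
| "cfrac_value (w # v # ws) = of_int w + 1 / cfrac_value (v # ws)"

definition convergent_of :: "real \<Rightarrow> nat \<Rightarrow> rat" where
  "convergent_of \<beta> n = cfrac_value (map (partial_quotient \<beta>) [0..<Suc n])"

text \<open>\<^const>\<open>quotient_of\<close> gives numerator and positive denominator in lowest terms.\<close>

definition convergent_denom :: "real \<Rightarrow> nat \<Rightarrow> int" where
  "convergent_denom \<beta> n = snd (quotient_of (convergent_of \<beta> n))"

text \<open>Only the values of \<open>c\<close> on \<open>[0, 1)\<close> and those of \<open>\<gamma>\<close> on \<open>{0..d}\<close> matter.\<close>

definition piecewise_constant_with :: "(real \<Rightarrow> 'a) \<Rightarrow> nat \<Rightarrow> (nat \<Rightarrow> real) \<Rightarrow> bool" where
  "piecewise_constant_with c d \<gamma> \<longleftrightarrow>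
     \<gamma> 0 = 0 \<and> \<gamma> d = 1 \<and>
     (\<forall>j\<in>{1..d}. \<gamma> (j - 1) < \<gamma> j) \<and>
     (\<forall>j\<in>{1..d}. \<forall>x\<in>{\<gamma> (j - 1)..<\<gamma> j}. \<forall>y\<in>{\<gamma> (j - 1)..<\<gamma> j}. c x = c y)"

text \<open>
  Indices are integers because \<open>r\<^sub>n = -1\<close> is allowed below; \<open>subword\<close> is only used with
  \<open>0 \<le> r \<le> s\<close>.
\<close>

definition subword :: "(nat \<Rightarrow> 'a) \<Rightarrow> int \<Rightarrow> int \<Rightarrow> 'a list" where
  "subword a r s = map (\<lambda>k. a (nat k)) [r..s]"

definition Dio_admissible :: "(nat \<Rightarrow> 'a) \<Rightarrow> real \<Rightarrow> bool" where
  "Dio_admissible a \<rho> \<longleftrightarrow>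
     (\<exists>r s t :: nat \<Rightarrow> int.
        (\<forall>n. -1 \<le> r n \<and> r n < s n \<and> s n < t n \<and>
             subword a (r n + 1) (r n + t n - s n) = subword a (s n + 1) (t n) \<and>
             real_of_int (t n) \<ge> \<rho> * real_of_int (s n)) \<and>
        filterlim (\<lambda>n. s n - r n) at_top sequentially)"

definition Dio :: "(nat \<Rightarrow> 'a) \<Rightarrow> ereal" where
  "Dio a = Sup {ereal \<rho> | \<rho>. Dio_admissible a \<rho>}"

end

theory Submission
  imports Defs
begin

text \<open>
  If \<open>q\<^sub>n\<^sub>+\<^sub>1\<close> is much larger than \<open>q = q\<^sub>n\<close> to the power \<open>l\<close>, then \<open>\<beta> = p/q + \<epsilon>\<close> with \<open>\<epsilon> x ^ l\<close>
  much smaller than \<open>1/q\<close> for all \<open>x \<le> K q\<close>, with \<open>K\<close> arbitrarily large. The values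
  \<open>p x ^ l / q\<close> are periodic modulo 1 in \<open>x\<close> with period \<open>q\<close>, and each of them either is a
  boundary point \<open>\<gamma> j\<close> or stays at distance at least \<open>1/(D q)\<close> from all of them, where \<open>D\<close> is a common
  denominator of the \<open>\<gamma> j\<close>. As \<open>\<epsilon> x ^ l\<close> has constant sign for \<open>x \<ge> 1\<close>, values at a boundary
  are always pushed to the same side. Hence \<open>a\<close> has period \<open>q\<close> on \<open>{1..K q}\<close>, so that
  \<open>Dio a \<ge> K\<close>.
\<close>

section \<open>Convergents\<close>

text \<open>
  The entries \<open>(a, b, c, d)\<close> of the product of the matrices with rows \<open>(w, 1)\<close> and \<open>(1, 0)\<close>
  for \<open>w\<close> in the list; \<open>a / c\<close> is the value of the list, \<open>b / d\<close> that of the list without its last entry.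
\<close>

fun cf_matrix :: "int list \<Rightarrow> int \<times> int \<times> int \<times> int" where
  "cf_matrix [] = (1, 0, 0, 1)"
| "cf_matrix (w # ws) = (case cf_matrix ws of (a, b, c, d) \<Rightarrow> (w * a + c, w * b + d, a, b))"

lemma cf_matrix_snoc:
  "cf_matrix ws = (a, b, c, d) \<Longrightarrow> cf_matrix (ws @ [w]) = (a * w + b, a, c * w + d, c)"
  by (induction ws arbitrary: a b c d) (auto split: prod.splits simp: algebra_simps)

text \<open>Every factor has determinant -1. This yields both that the convergents are in lowest
  terms and that the numerator of the approximation error is 1.\<close>

lemma cf_matrix_det:
  "cf_matrix ws = (a, b, c, d) \<Longrightarrow> \<bar>a * d - b * c\<bar> = 1"
proof (induction ws arbitrary: a b c d)
  case (Cons w ws)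
  obtain a' b' c' d' where eq: "cf_matrix ws = (a', b', c', d')"
    by (cases "cf_matrix ws")
  have "a * d - b * c = - (a' * d' - b' * c')"
    using Cons.prems eq by (auto simp: algebra_simps)
  with Cons.IH[OF eq] show ?case by simp
qed simp

lemma cf_matrix_nonneg:
  assumes "cf_matrix ws = (a, b, c, d)" "\<forall>w\<in>set ws. 1 \<le> w"
  shows "1 \<le> a \<and> 0 \<le> b \<and> 0 \<le> c \<and> 0 \<le> d"
  using assms
proof (induction ws arbitrary: a b c d)
  case (Cons w ws)
  obtain a' b' c' d' where eq: "cf_matrix ws = (a', b', c', d')"
    by (cases "cf_matrix ws")
  have IH: "1 \<le> a'" "0 \<le> b'" "0 \<le> c'" "0 \<le> d'" and "1 \<le> w"
    using Cons.IH[OF eq] Cons.prems(2) by auto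
  then have "1 * 1 \<le> w * a'" "0 \<le> w * b'"
    by (intro mult_mono mult_nonneg_nonneg; simp)+
  with IH Cons.prems(1) eq show ?case by auto
qed simp

text \<open>The bottom row is the top row of the matrix of \<open>ws\<close>, so the first entry
  \<open>w\<close> does not enter. This matters because the integer part of \<beta> may be zero or
  negative.\<close>

lemma cf_matrix_denom_pos:
  assumes "cf_matrix (w # ws) = (a, b, c, d)" "\<forall>w\<in>set ws. 1 \<le> w"
  shows "1 \<le> c" "0 \<le> d"
  using assms cf_matrix_nonneg[of ws] by (auto split: prod.splits)

lemma cfrac_value_eq_cf_matrix:
  assumes "cf_matrix (w # ws) = (a, b, c, d)" "\<forall>w\<in>set ws. 1 \<le> w"
  shows "cfrac_value (w # ws) = of_int a / of_int c"
  using assms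
proof (induction ws arbitrary: w a b c d)
  case (Cons v vs)
  obtain a' b' c' d' where eq: "cf_matrix (v # vs) = (a', b', c', d')"
    by (cases "cf_matrix (v # vs)")
  have "1 \<le> a'"
    using cf_matrix_nonneg[OF eq] Cons.prems(2) by auto
  moreover have "cfrac_value (v # vs) = of_int a' / of_int c'"
    using Cons.IH[OF eq] Cons.prems(2) by simp
  moreover have "a = w * a' + c'" "c = a'"
    using Cons.prems(1) eq by (auto split: prod.splits)
  ultimately show ?case by (simp add: field_simps)
qed auto

section \<open>Complete quotients and the approximation error of convergents\<close>

lemma complete_quotient_irrational:
  "\<beta> \<notin> \<rat> \<Longrightarrow> complete_quotient \<beta> n \<notin> \<rat>"
proof (induction n)
  case (Suc n)
  show ?case
  proof
    assume "complete_quotient \<beta> (Suc n) \<in> \<rat>"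
    from Rats_divide[OF Rats_1 this] have "frac (complete_quotient \<beta> n) \<in> \<rat>" by simp
    from Rats_add[OF this Rats_of_int[of "\<lfloor>complete_quotient \<beta> n\<rfloor>"]]
    show False using Suc by (simp add: frac_def)
  qed
qed simp

lemma frac_complete_quotient_pos:
  assumes "\<beta> \<notin> \<rat>"
  shows "0 < frac (complete_quotient \<beta> n)"
proof -
  have "complete_quotient \<beta> n \<notin> \<int>"
    using complete_quotient_irrational[OF assms, of n] Ints_subset_Rats by blast
  then show ?thesis by (simp add: frac_gt_0_iff)
qed

lemma partial_quotient_ge_1:
  assumes "\<beta> \<notin> \<rat>"
  shows "1 \<le> partial_quotient \<beta> (Suc n)"
  using frac_complete_quotient_pos[OF assms, of n] frac_lt_1[of "complete_quotient \<beta> n"]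
  by (simp add: partial_quotient_def le_floor_iff field_simps)

abbreviation partial_quotients :: "real \<Rightarrow> nat \<Rightarrow> int list" where
  "partial_quotients \<beta> n \<equiv> map (partial_quotient \<beta>) [0..<n]"

lemma partial_quotients_Cons:
  "partial_quotients \<beta> (Suc n) = partial_quotient \<beta> 0 # map (partial_quotient \<beta>) [1..<Suc n]"
  by (subst upt_conv_Cons) simp_all

lemma partial_quotients_tail_ge_1:
  assumes "\<beta> \<notin> \<rat>"
  shows "\<forall>w\<in>set (map (partial_quotient \<beta>) [1..<Suc n]). 1 \<le> w"
proof -
  have "1 \<le> partial_quotient \<beta> i" if "1 \<le> i" for i
    using that partial_quotient_ge_1[OF assms, of "i - 1"] by simp
  then show ?thesis by auto
qed

text \<open>This is \<beta> = (a x + b) / (c x + d), with x the n-th complete quotient, written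
  without division.\<close>

lemma complete_quotient_moebius:
  assumes "\<beta> \<notin> \<rat>" "cf_matrix (partial_quotients \<beta> n) = (a, b, c, d)"
  shows "\<beta> * (c * complete_quotient \<beta> n + d) = a * complete_quotient \<beta> n + b"
  using assms(2)
proof (induction n arbitrary: a b c d)
  case (Suc n)
  obtain a' b' c' d' where eq: "cf_matrix (partial_quotients \<beta> n) = (a', b', c', d')"
    by (cases "cf_matrix (partial_quotients \<beta> n)")
  define x x' w where "x = complete_quotient \<beta> n" and "x' = complete_quotient \<beta> (Suc n)"
    and "w = partial_quotient \<beta> n"
  have coeffs: "a = a' * w + b'" "b = a'" "c = c' * w + d'" "d = c'"
    using Suc.prems cf_matrix_snoc[OF eq, of w] by (auto simp: w_def)
  have "(x - w) * x' = 1"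
    using frac_complete_quotient_pos[OF assms(1), of n]
    by (simp add: x_def x'_def w_def partial_quotient_def frac_def)
  then have "x * x' = w * x' + 1" by (simp add: algebra_simps)
  \<comment> \<open>Multiplying by x' leaves x only in the product x x', which the recursion
    replaces by w x' + 1.\<close>
  moreover have "\<beta> * (c' * x + d') * x' = (a' * x + b') * x'"
    using Suc.IH[OF eq] by (simp add: x_def)
  then have "\<beta> * (c' * (x * x') + d' * x') = a' * (x * x') + b' * x'"
    by (simp add: algebra_simps)
  ultimately have "\<beta> * (c' * (w * x' + 1) + d' * x') = a' * (w * x' + 1) + b' * x'"
    by simp
  then show ?case
    unfolding x'_def[symmetric] by (simp add: coeffs algebra_simps)
qed simp

lemma convergent_denom_eq:
  assumes "\<beta> \<notin> \<rat>" "cf_matrix (partial_quotients \<beta> (Suc n)) = (a, b, c, d)"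
  shows "convergent_denom \<beta> n = c"
proof -
  note mat = assms(2)[unfolded partial_quotients_Cons]
  note ge1 = partial_quotients_tail_ge_1[OF assms(1), of n]
  have "convergent_of \<beta> n = of_int a / of_int c"
    unfolding convergent_of_def partial_quotients_Cons
    by (rule cfrac_value_eq_cf_matrix[OF mat ge1])
  also have "\<dots> = Fract a c" by (simp add: Fract_of_int_quotient)
  finally have "convergent_of \<beta> n = Fract a c" .
  moreover have "0 < c" using cf_matrix_denom_pos[OF mat ge1] by simp
  moreover have "coprime a c"
  proof (rule coprimeI)
    fix e assume "e dvd a" "e dvd c"
    then have "e dvd a * d - b * c" by simp
    then show "is_unit e" using cf_matrix_det[OF assms(2)] by (metis dvd_abs_iff)
  qed
  ultimately show ?thesis
    unfolding convergent_denom_def by (simp add: quotient_of_Fract Let_def)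
qed

text \<open>By the Moebius relation and the determinant, the error is exactly 1 / (c (c x + d)).
  Replacing x by its floor w turns c x + d into the next denominator. Growth is claimed from index 1
  only, since the first two denominators are both 1 when the partial quotient at index 1 is
  1.\<close>

lemma convergent_error:
  assumes "\<beta> \<notin> \<rat>"
  shows "0 < convergent_denom \<beta> n" (is ?pos)
    and "\<exists>p::int. \<bar>\<beta> - p / convergent_denom \<beta> n\<bar>
           \<le> 1 / (real_of_int (convergent_denom \<beta> n) * convergent_denom \<beta> (Suc n))" (is ?error)
    and "1 \<le> n \<Longrightarrow> convergent_denom \<beta> n < convergent_denom \<beta> (Suc n)"
proof -
  obtain a b c d where eq: "cf_matrix (partial_quotients \<beta> (Suc n)) = (a, b, c, d)"
    by (cases "cf_matrix (partial_quotients \<beta> (Suc n))")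
  define x w where "x = complete_quotient \<beta> (Suc n)" and "w = partial_quotient \<beta> (Suc n)"
  have snoc: "cf_matrix (partial_quotients \<beta> (Suc (Suc n))) = (a * w + b, a, c * w + d, c)"
    using cf_matrix_snoc[OF eq, of w] by (simp add: w_def)
  have q: "convergent_denom \<beta> n = c" and q': "convergent_denom \<beta> (Suc n) = c * w + d"
    using convergent_denom_eq[OF assms eq] convergent_denom_eq[OF assms snoc] by auto
  have "1 \<le> c" "0 \<le> d"
    using cf_matrix_denom_pos[OF eq[unfolded partial_quotients_Cons]
        partial_quotients_tail_ge_1[OF assms]] by auto
  then show ?pos using q by simp
  have "1 \<le> w" unfolding w_def by (rule partial_quotient_ge_1[OF assms])
  then have "c * 1 \<le> c * w" using \<open>1 \<le> c\<close> by (intro mult_left_mono) auto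
  have "real_of_int w \<le> x" by (simp add: w_def x_def partial_quotient_def)
  then have le: "real_of_int (c * w + d) \<le> c * x + d"
    using \<open>1 \<le> c\<close> by simp
  have pos: "0 < real_of_int (c * w + d)"
    using \<open>c * 1 \<le> c * w\<close> \<open>1 \<le> c\<close> \<open>0 \<le> d\<close> by linarith
  have X: "0 < c * x + d" using pos le by (rule less_le_trans)
  have "\<beta> * (c * x + d) = a * x + b"
    using complete_quotient_moebius[OF assms eq] by (simp add: x_def)
  moreover have "(\<beta> - a / c) * (c * (c * x + d)) = c * (\<beta> * (c * x + d)) - a * (c * x + d)"
    using \<open>1 \<le> c\<close> by (simp add: left_diff_distrib)
  ultimately have "(\<beta> - a / c) * (c * (c * x + d)) = - real_of_int (a * d - b * c)"
    by (simp add: algebra_simps)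
  then have "\<beta> - a / c = - real_of_int (a * d - b * c) / (c * (c * x + d))"
    using X \<open>1 \<le> c\<close> by (simp add: eq_divide_eq)
  then have "\<bar>\<beta> - a / c\<bar> = of_int \<bar>a * d - b * c\<bar> / (c * (c * x + d))"
    using X \<open>1 \<le> c\<close> by (simp only: abs_divide abs_minus_cancel of_int_abs) (simp add: abs_mult)
  also have "\<dots> = 1 / (c * (c * x + d))"
    by (simp only: cf_matrix_det[OF eq] of_int_1)
  also have "\<dots> \<le> 1 / (real_of_int c * of_int (c * w + d))"
    using le pos X \<open>1 \<le> c\<close> by (intro divide_left_mono mult_left_mono mult_pos_pos) auto
  finally show ?error unfolding q q' by blast
  assume "1 \<le> n"
  then obtain m where n: "n = Suc m" by (cases n) auto
  obtain a' b' c' d' where eq': "cf_matrix (partial_quotients \<beta> n) = (a', b', c', d')"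
    by (cases "cf_matrix (partial_quotients \<beta> n)")
  \<comment> \<open>The entry d is the preceding denominator, hence at least 1; for n = 0 it would
    be 0.\<close>
  have "d = c'"
    using cf_matrix_snoc[OF eq', of "partial_quotient \<beta> n"] eq by simp
  moreover have "1 \<le> c'"
    using cf_matrix_denom_pos[OF eq'[unfolded n partial_quotients_Cons]
        partial_quotients_tail_ge_1[OF assms]] by auto
  ultimately show "convergent_denom \<beta> n < convergent_denom \<beta> (Suc n)"
    using \<open>c * 1 \<le> c * w\<close> q q' by simp
qed

lemma convergent_denom_ge:
  assumes "\<beta> \<notin> \<rat>"
  shows "int n \<le> convergent_denom \<beta> n"
proof (induction n)
  case 0
  show ?case using convergent_error(1)[OF assms, of 0] by simp
next
  case (Suc n)
  then show ?case
    using convergent_error(3)[OF assms, of n] convergent_error(1)[OF assms, of "Suc n"]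
    by (cases "n = 0") auto
qed

text \<open>For infinitely many n the next denominator exceeds M times the l-th power of the current
  one, q. The error bound then gives the claim, and q >= n makes q as large as desired.\<close>

lemma good_approximation:
  fixes M :: real
  assumes "\<beta> \<notin> \<rat>"
    and "limsup (\<lambda>n. ereal (real_of_int (convergent_denom \<beta> (Suc n)) /
                             real_of_int (convergent_denom \<beta> n) ^ l)) = \<infinity>"
    and "0 < M"
  shows "\<exists>(p::int) (q::int). int m \<le> q \<and> 0 < q \<and> M * real_of_int q ^ l * \<bar>\<beta> - p / q\<bar> < 1 / q"
proof -
  let ?q = "convergent_denom \<beta>"
  have "\<exists>n\<ge>m. ereal M < ereal (real_of_int (?q (Suc n)) / real_of_int (?q n) ^ l)"
  proof (rule ccontr)
    assume "\<not> ?thesis"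
    then have "\<forall>\<^sub>F n in sequentially.
        ereal (real_of_int (?q (Suc n)) / real_of_int (?q n) ^ l) \<le> ereal M"
      unfolding eventually_sequentially by (metis not_le)
    then have "limsup (\<lambda>n. ereal (real_of_int (?q (Suc n)) / real_of_int (?q n) ^ l)) \<le> ereal M"
      by (rule Limsup_bounded)
    with assms(2) show False by simp
  qed
  then obtain n where "m \<le> n"
    and large: "M < real_of_int (?q (Suc n)) / real_of_int (?q n) ^ l" by auto
  have pos: "0 < ?q n" "0 < ?q (Suc n)" using convergent_error(1)[OF assms(1)] by auto
  obtain p :: int where p: "\<bar>\<beta> - p / ?q n\<bar> \<le> 1 / (real_of_int (?q n) * ?q (Suc n))"
    using convergent_error(2)[OF assms(1)] by blast
  have "M * real_of_int (?q n) ^ l * \<bar>\<beta> - p / ?q n\<bar> \<le> M * real_of_int (?q n) ^ l * (1 / (real_of_int (?q n) * ?q (Suc n)))"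
    using p pos assms(3) by (intro mult_left_mono) auto
  also have "\<dots> = (M * real_of_int (?q n) ^ l / ?q (Suc n)) * (1 / ?q n)"
    by simp
  also have "\<dots> < 1 * (1 / ?q n)"
    using large pos by (intro mult_strict_right_mono) (auto simp: field_simps)
  finally show ?thesis
    using pos convergent_denom_ge[OF assms(1), of n] \<open>m \<le> n\<close>
    by (intro exI[of _ p] exI[of _ "?q n"]) auto
qed

section \<open>Piecewise constant functions with rational boundaries\<close>

lemma finite_Rats_common_denominator:
  assumes "finite S" "S \<subseteq> (\<rat> :: real set)"
  shows "\<exists>D::int. 0 < D \<and> (\<forall>x\<in>S. D * x \<in> \<int>)"
  using assms
proof (induction S rule: finite_induct)
  case empty
  show ?case by (auto intro: exI[of _ 1])
next
  case (insert x S)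
  then obtain D :: int where D: "0 < D" "\<forall>y\<in>S. D * y \<in> \<int>" by auto
  obtain i j :: int where ij: "0 < j" "x = i / j"
    using insert.prems by (auto elim: Rats_cases')
  have "real_of_int (D * j) * x = of_int (D * i)" using ij by simp
  moreover have "real_of_int (D * j) * y \<in> \<int>" if "y \<in> S" for y
  proof -
    have "of_int j * (of_int D * y) \<in> \<int>"
      by (rule Ints_mult[OF Ints_of_int]) (use D that in blast)
    then show ?thesis by (simp add: mult_ac)
  qed
  ultimately show ?case
    using D ij by (intro exI[of _ "D * j"]) (auto simp del: of_int_mult)
qed

text \<open>Since D \<gamma>_j is an integer, the floor of D x decides on which side of each
  boundary x lies. Comparing colours thus reduces to comparing floors.\<close>

lemma piecewise_constant_cong:
  assumes pc: "piecewise_constant_with c d \<gamma>"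
    and D: "0 < D" "\<forall>j\<in>{0..d}. real_of_int D * \<gamma> j \<in> \<int>"
    and x: "x \<in> {0..<1}" and y: "y \<in> {0..<1}"
    and fl: "\<lfloor>D * x\<rfloor> = \<lfloor>D * y\<rfloor>"
  shows "c x = c y"
proof -
  have same_side: "x < \<gamma> j \<longleftrightarrow> y < \<gamma> j" if j: "j \<le> d" for j
  proof -
    obtain z where z: "real_of_int D * \<gamma> j = of_int z"
      using D(2) j Ints_cases[of "real_of_int D * \<gamma> j"] by auto
    have "u < \<gamma> j \<longleftrightarrow> \<lfloor>D * u\<rfloor> < z" for u :: real
      using D(1) by (simp add: floor_less_iff flip: z)
    then show ?thesis using fl by simp
  qed
  \<comment> \<open>The right end of the piece containing x.\<close>
  define j where "j = (LEAST j. x < \<gamma> j)"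
  have xd: "x < \<gamma> d" using pc x by (auto simp: piecewise_constant_with_def)
  have xj: "x < \<gamma> j" unfolding j_def using xd by (rule LeastI)
  have jd: "j \<le> d" unfolding j_def using xd by (rule Least_le)
  have "j \<noteq> 0" using xj pc x by (auto simp: piecewise_constant_with_def intro: gr0I)
  then have "\<not> x < \<gamma> (j - 1)" unfolding j_def by (intro not_less_Least) simp
  then have "x \<in> {\<gamma> (j - 1)..<\<gamma> j}" "y \<in> {\<gamma> (j - 1)..<\<gamma> j}"
    using same_side[OF jd] same_side[of "j - 1"] jd xj by (simp_all add: not_less)
  moreover have "j \<in> {1..d}" using \<open>j \<noteq> 0\<close> jd by simp
  ultimately show ?thesis using pc unfolding piecewise_constant_with_def by blast
qed

lemma piecewise_constant_frac_cong:
  assumes "piecewise_constant_with c d \<gamma>"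
    and "0 < D" "\<forall>j\<in>{0..d}. real_of_int D * \<gamma> j \<in> \<int>"
    and fl: "\<lfloor>D * x\<rfloor> = \<lfloor>D * y\<rfloor>"
  shows "c (frac x) = c (frac y)"
proof (rule piecewise_constant_cong[OF assms(1-3)])
  \<comment> \<open>The floor at scale D also determines the integer part, so it survives the
    reduction modulo 1.\<close>
  have "\<lfloor>u\<rfloor> = \<lfloor>D * u\<rfloor> div D" for u :: real
    using floor_divide_real_eq_div[of D "D * u"] assms(2) by simp
  then have "\<lfloor>x\<rfloor> = \<lfloor>y\<rfloor>" using fl by metis
  moreover have "\<lfloor>D * frac u\<rfloor> = \<lfloor>D * u\<rfloor> - D * \<lfloor>u\<rfloor>" for u :: real
  proof -
    have "D * frac u = D * u - of_int (D * \<lfloor>u\<rfloor>)" by (simp add: frac_def right_diff_distrib)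
    then show ?thesis by (simp only: floor_diff_of_int)
  qed
  ultimately show "\<lfloor>D * frac x\<rfloor> = \<lfloor>D * frac y\<rfloor>" using fl by simp
qed (auto simp: frac_lt_1)

section \<open>Periodicity of the coding on an initial segment\<close>

lemma floor_small_perturbation:
  fixes m q :: int and \<eta> \<theta> :: real
  assumes "0 < q" "\<bar>\<eta>\<bar> < 1 / q" "\<bar>\<theta>\<bar> < 1 / q" "\<eta> < 0 \<longleftrightarrow> \<theta> < 0"
  shows "\<lfloor>m / q + \<eta>\<rfloor> = \<lfloor>m / q + \<theta>\<rfloor>"
proof -
  \<comment> \<open>The shift does not reach the neighbouring multiples of 1/q, so only its sign
    counts. Zero goes with the positive shifts, in accordance with the half-open pieces.\<close>
  have "\<lfloor>m / q + u\<rfloor> = (if u < 0 then m - 1 else m) div q" if u: "\<bar>u\<bar> < 1 / q" for u :: real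
  proof -
    have "\<bar>u * q\<bar> < 1" using u assms(1) by (simp add: field_simps abs_mult)
    moreover have "u * q < 0 \<longleftrightarrow> u < 0" using assms(1) by (simp add: mult_less_0_iff)
    ultimately have "\<lfloor>m + u * q\<rfloor> = (if u < 0 then m - 1 else m)"
      by (auto intro!: floor_unique)
    moreover have "m / q + u = (m + u * q) / q" using assms(1) by (simp add: field_simps)
    ultimately show ?thesis
      using floor_divide_real_eq_div[of q "m + u * q"] assms(1) by simp
  qed
  then show ?thesis using assms by simp
qed

text \<open>The factor K^l in \<open>approx\<close> covers all arguments up to K q, and D
  compensates the scaling by D. Position 0 is excluded: for l > 0 the perturbation vanishes there,
  which breaks the agreement of signs when \<beta> < p/q.\<close>

lemma coding_periodic:
  fixes p q D :: int and K k l :: nat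
  assumes pc: "piecewise_constant_with c d \<gamma>"
    and D: "0 < D" "\<forall>j\<in>{0..d}. real_of_int D * \<gamma> j \<in> \<int>"
    and q: "0 < q"
    and approx: "real_of_int D * real K ^ l * real_of_int q ^ l * \<bar>\<beta> - p / q\<bar> < 1 / q"
    and k: "1 \<le> k" "int k + q \<le> K * q"
  shows "c (frac (\<beta> * real k ^ l)) = c (frac (\<beta> * real (k + nat q) ^ l))"
proof -
  define \<epsilon> where "\<epsilon> = \<beta> - p / q"
  define x where "x = k + nat q"
  have small: "\<bar>D * (\<epsilon> * real z ^ l)\<bar> < 1 / q" if "int z \<le> K * q" for z
  proof -
    have "real z \<le> K * q" using that by (metis of_int_le_iff of_int_mult of_int_of_nat_eq)
    then have "real z ^ l \<le> (real K * q) ^ l" by (intro power_mono) auto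
    then have "D * \<bar>\<epsilon>\<bar> * real z ^ l \<le> D * \<bar>\<epsilon>\<bar> * (real K * q) ^ l"
      using D by (intro mult_left_mono) auto
    also have "\<dots> < 1 / q" using approx by (simp add: \<epsilon>_def power_mult_distrib mult_ac)
    finally show ?thesis using D by (simp add: abs_mult mult_ac)
  qed
  \<comment> \<open>Congruence modulo q passes to l-th powers, so p x^l / q and p k^l / q differ by
    the integer p e.\<close>
  have "q dvd int x - int k" using q by (simp add: x_def)
  then have "q dvd int x ^ l - int k ^ l"
    by (metis dvd_trans power_diff_sumr2 dvd_triv_left)
  then obtain e where e: "int x ^ l = int k ^ l + q * e"
    by (auto simp: dvd_def algebra_simps)
  then have e': "real x ^ l = real k ^ l + q * e"
    by (metis of_int_add of_int_mult of_int_of_nat_eq of_int_power)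
  have eqk: "D * (\<beta> * real k ^ l) = real_of_int (D * p * int k ^ l) / q + D * (\<epsilon> * real k ^ l)"
    by (simp add: \<epsilon>_def algebra_simps)
  have "real_of_int (D * p) / q * real x ^ l = real_of_int (D * p * int k ^ l) / q + of_int (D * p * e)"
    using q by (simp add: e' field_simps)
  then have "D * (\<beta> * real x ^ l)
      = (real_of_int (D * p * int k ^ l) / q + D * (\<epsilon> * real x ^ l)) + of_int (D * p * e)"
    by (simp add: \<epsilon>_def algebra_simps)
  \<comment> \<open>The integer p e is removed before scaling by D: the floors at scale D can then
    agree, while the fractional part is unchanged.\<close>
  then have "\<lfloor>D * (\<beta> * real x ^ l - of_int (p * e))\<rfloor>
      = \<lfloor>real_of_int (D * p * int k ^ l) / q + D * (\<epsilon> * real x ^ l)\<rfloor>"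
    by (simp add: algebra_simps)
  also have "\<dots> = \<lfloor>real_of_int (D * p * int k ^ l) / q + D * (\<epsilon> * real k ^ l)\<rfloor>"
  proof (rule floor_small_perturbation[OF q])
    show "\<bar>D * (\<epsilon> * real x ^ l)\<bar> < 1 / q" "\<bar>D * (\<epsilon> * real k ^ l)\<bar> < 1 / q"
      using k q by (intro small; simp add: x_def)+
    have "D * (\<epsilon> * real z ^ l) < 0 \<longleftrightarrow> \<epsilon> < 0" if "1 \<le> z" for z
      using D that by (simp add: mult_less_0_iff zero_less_mult_iff)
    from this[of x] this[of k]
    show "(D * (\<epsilon> * real x ^ l) < 0) = (D * (\<epsilon> * real k ^ l) < 0)"
      using k by (simp add: x_def)
  qed
  finally have "\<lfloor>D * (\<beta> * real k ^ l)\<rfloor> = \<lfloor>D * (\<beta> * real x ^ l - of_int (p * e))\<rfloor>"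
    by (simp only: eqk)
  then have "c (frac (\<beta> * real k ^ l)) = c (frac (\<beta> * real x ^ l - of_int (p * e)))"
    by (rule piecewise_constant_frac_cong[OF pc D])
  also have "frac (\<beta> * real x ^ l - of_int (p * e)) = frac (\<beta> * real x ^ l)"
    by (simp add: frac_def flip: of_int_mult)
  finally show ?thesis by (simp add: x_def)
qed

section \<open>The Diophantine exponent\<close>

text \<open>Take r = 0, s = q and t = K q: the word at positions 1 to (K - 1) q recurs at q + 1 to K
  q, and t = K s. The choice r = 0 rather than -1 skips position 0, and q >= m makes s - r tend to
  infinity.\<close>

lemma Dio_admissible_of_periodic_prefixes:
  fixes K :: nat
  assumes "2 \<le> K"
    and periodic: "\<And>m. \<exists>q::nat. m \<le> q \<and> 0 < q \<and>
                    (\<forall>k\<ge>1. k + q \<le> K * q \<longrightarrow> a k = a (k + q))"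
  shows "Dio_admissible a K"
proof -
  obtain q :: "nat \<Rightarrow> nat" where q: "\<And>m. m \<le> q m" "\<And>m. 0 < q m"
    "\<And>m k. 1 \<le> k \<Longrightarrow> k + q m \<le> K * q m \<Longrightarrow> a k = a (k + q m)"
    using periodic by metis
  have "subword a (0 + 1) (0 + int (K * q m) - int (q m)) = subword a (int (q m) + 1) (int (K * q m))"
    for m
  proof (rule nth_equalityI)
    fix i assume "i < length (subword a (0 + 1) (0 + int (K * q m) - int (q m)))"
    then have i: "int i < int (K * q m) - int (q m)" by (simp add: subword_def)
    then have "i + 1 + q m \<le> K * q m" by linarith
    then have "a (i + 1) = a (i + 1 + q m)" by (intro q(3)) auto
    moreover have "nat (1 + int i) = i + 1" "nat (int (q m) + 1 + int i) = i + 1 + q m" by auto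
    moreover have "[0 + 1..0 + int (K * q m) - int (q m)] ! i = 1 + int i"
      "[int (q m) + 1..int (K * q m)] ! i = int (q m) + 1 + int i"
      using i by (auto intro!: trans[OF nth_upto])
    ultimately show "subword a (0 + 1) (0 + int (K * q m) - int (q m)) ! i
        = subword a (int (q m) + 1) (int (K * q m)) ! i"
      using i by (simp add: subword_def del: of_nat_mult)
  qed (simp add: subword_def)
  moreover have "q m < K * q m" for m using assms(1) q(2)[of m] by simp
  moreover have "filterlim (\<lambda>m. int (q m) - 0) at_top sequentially"
    using q(1) by (auto intro!: filterlim_at_top_mono[OF filterlim_int_sequentially] always_eventually)
  ultimately show ?thesis
    unfolding Dio_admissible_def
    using q(2)
    by (intro exI[of _ "\<lambda>_. 0"] exI[of _ "\<lambda>m. int (q m)"] exI[of _ "\<lambda>m. int (K * q m)"])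
       (auto simp del: of_nat_mult simp: of_nat_mult[where ?'a = real])
qed

theorem theorem8p8:
  fixes l :: nat and \<beta> :: real and g :: "real \<Rightarrow> real"
    and \<Sigma> :: "'a set" and c :: "real \<Rightarrow> 'a"
    and d :: nat and \<gamma> :: "nat \<Rightarrow> real" and a :: "nat \<Rightarrow> 'a"
  assumes "l \<ge> 2"
    and "\<beta> \<notin> \<rat>"
    and "\<And>x. g x = \<beta> * x ^ l"
    and "finite \<Sigma>"
    and "c ` {0..<1} \<subseteq> \<Sigma>"
    and "\<not> (\<exists>v. \<forall>x\<in>{0..<1}. c x = v)"
    and "piecewise_constant_with c d \<gamma>"
    and "\<forall>j\<in>{0..d}. \<gamma> j \<in> \<rat>"
    and "\<And>n. a n = c (frac (g (real n)))"
    and "limsup (\<lambda>n. ereal (real_of_int (convergent_denom \<beta> (Suc n)) /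
                             real_of_int (convergent_denom \<beta> n) ^ l)) = \<infinity>"
  shows "Dio a = \<infinity>"
proof -
  have "\<exists>D::int. 0 < D \<and> (\<forall>x\<in>\<gamma> ` {0..d}. D * x \<in> \<int>)"
    using assms(8) by (intro finite_Rats_common_denominator) auto
  then obtain D :: int where D: "0 < D" "\<forall>j\<in>{0..d}. real_of_int D * \<gamma> j \<in> \<int>"
    by auto
  have admissible: "Dio_admissible a (real K)" if "2 \<le> K" for K :: nat
  proof (rule Dio_admissible_of_periodic_prefixes[OF that])
    fix m
    \<comment> \<open>The constant M of \<open>good_approximation\<close> is chosen as D K^l to
      match \<open>coding_periodic\<close>.\<close>
    have "0 < real_of_int D * real K ^ l" using D(1) that by simp
    from good_approximation[OF assms(2) assms(10) this, of m] obtain p q :: int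
      where pq: "int m \<le> q" "0 < q" "real_of_int D * real K ^ l * real_of_int q ^ l * \<bar>\<beta> - p / q\<bar> < 1 / q"
      by auto
    have "a k = a (k + nat q)" if "1 \<le> k" "k + nat q \<le> K * nat q" for k
    proof -
      have "int (k + nat q) \<le> int (K * nat q)" using that(2) by (simp only: of_nat_le_iff)
      then have "int k + q \<le> K * q" using pq(2) by simp
      from coding_periodic[OF assms(7) D pq(2,3) that(1) this]
      show ?thesis by (simp add: assms(3,9))
    qed
    then show "\<exists>q. m \<le> q \<and> 0 < q \<and> (\<forall>k\<ge>1. k + q \<le> K * q \<longrightarrow> a k = a (k + q))"
      using pq by (intro exI[of _ "nat q"]) auto
  qed
  show ?thesis
  proof (rule ereal_top)
    fix B :: real
    obtain K :: nat where "max B 2 \<le> K" using real_arch_simple by blast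
    then have "Dio_admissible a (real K)" "B \<le> K" by (auto intro!: admissible)
    then have "ereal (real K) \<le> Dio a"
      unfolding Dio_def by (intro Sup_upper) blast
    with \<open>B \<le> K\<close> show "ereal B \<le> Dio a"
      by (meson ereal_less_eq(3) order_trans)
  qed
qed

end
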